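(* Let $k$ be a constant and let $\varphi:(M^2,g=dr^2+\sigma^2(r)d\theta^2)\longrightarrow (N^2,h=d\rho^2+\lambda^2(\rho)d\phi^2)$ be the rotationally symmetric map $\varphi(r,\theta)=(\rho(r),k\theta)$. Let $f=f(r,\theta)$ be a positive smooth function on $M^2$. Then $\varphi$ is an $f$-biharmonic map if and only if $f$ solves the system $$\begin{cases}\Delta(xf)=\dfrac{k^2(\lambda\lambda')'(\rho)}{\sigma^2}\,(xf),\\[4pt] \dfrac{k f_\theta\,\lambda'(\rho)\,x}{\sigma^2\lambda(\rho)}=0,\\[4pt] x=\Delta\rho-\dfrac{k^2\lambda(\rho)\lambda'(\rho)}{\sigma^2},\end{cases}$$ where $\Delta$ denotes the Laplacian on functions with respect to $g$ and $\rho=\rho(r)$. In particular, when $f=f(r)$ depends only on $r$, $\varphi$ is an $f$-biharmonic map if and only if $f$ solves $$\begin{cases} y''+\dfrac{\sigma'}{\sigma}y'-\dfrac{k^2(\lambda\lambda')'(\rho)}{\sigma^2}\,y=0,\\[4pt] y=fx,\\[4pt] x=\rho''+\dfrac{\sigma'}{\sigma}\rho'-\dfrac{k^2\lambda(\rho)\lambda'(\rho)}{\sigma^2},\end{cases}$$ where primes on $y,\rho,\sigma$ are derivatives with respect to $r$.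
   Context: For a smooth map $\phi:(M,g)\to(N,h)$ of Riemannian manifolds, $\tau(\phi)=\mathrm{Tr}_g\nabla d\phi$ is the tension field and $\tau_2(\phi)=\mathrm{Trace}_g(\nabla^\phi\nabla^\phi-\nabla^\phi_{\nabla^M})\tau(\phi)-\mathrm{Trace}_g R^N(d\phi,\tau(\phi))d\phi$ is the bitension field, with $R^N(X,Y)Z=[\nabla^N_X,\nabla^N_Y]Z-\nabla^N_{[X,Y]}Z$. For a positive smooth function $f$ on $M$, the map is $f$-biharmonic if $f\tau_2(\phi)+(\Delta f)\tau(\phi)+2\nabla^\phi_{\mathrm{grad} f}\tau(\phi)=0$. Here $(r,\theta)$ and $(\rho,\phi)$ are polar-type coordinates on $M^2$, $N^2$ ($\theta,\phi$ angular), $\sigma$ and $\lambda$ are positive smooth functions of one variable, $\lambda'=d\lambda/d\rho$, and $(\lambda\lambda')'(\rho)$ is the derivative of $\lambda\lambda'$ with respect to $\rho$, evaluated at $\rho=\rho(r)$. When $k$ is not an integer the statement is understood in local coordinates (locally in $\theta$). *)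

theory Defs
  imports "HOL-Analysis.Analysis"
begin

text \<open>
  Riemannian geometry in a coordinate chart. A Riemannian metric on an open set of
  \<open>real ^ 'n\<close> is given by its Gram matrix \<open>g p $ i $ j = g(\<partial>\<^sub>i, \<partial>\<^sub>j)\<close>; vector fields, and sections
  along a map, are functions into \<open>real ^ 'n\<close> (components in the coordinate frame).
\<close>

text \<open>\<open>C\<^sup>n\<close>, respectively \<open>C\<^sup>\<infinity>\<close>, on an open set.\<close>

fun C_diff_on :: "nat \<Rightarrow> 'a::real_normed_vector set \<Rightarrow> ('a \<Rightarrow> 'b::real_normed_vector) \<Rightarrow> bool" where
  "C_diff_on 0 S F \<longleftrightarrow> continuous_on S F"
| "C_diff_on (Suc n) S F \<longleftrightarrow>
     (\<forall>x\<in>S. F differentiable (at x)) \<and> (\<forall>v. C_diff_on n S (\<lambda>x. frechet_derivative F (at x) v))"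

definition smooth_on :: "'a::real_normed_vector set \<Rightarrow> ('a \<Rightarrow> 'b::real_normed_vector) \<Rightarrow> bool" where
  "smooth_on S F \<longleftrightarrow> (\<forall>n. C_diff_on n S F)"

definition coord_field :: "'m \<Rightarrow> real ^ 'm \<Rightarrow> real ^ 'm::finite" where
  "coord_field i = (\<lambda>p. axis i 1)"

text \<open>\<open>differential F X\<close> is \<open>p \<mapsto> dF\<^sub>p(X\<^sub>p)\<close>: the section \<open>dF(X)\<close> along a map \<open>F\<close>, or \<open>X F\<close> for a function.\<close>

definition differential ::
    "(real ^ 'm \<Rightarrow> 'b::real_normed_vector) \<Rightarrow> (real ^ 'm \<Rightarrow> real ^ 'm) \<Rightarrow> real ^ 'm::finite \<Rightarrow> 'b" where
  "differential F X p = frechet_derivative F (at p) (X p)"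

abbreviation partial_deriv :: "'m \<Rightarrow> (real ^ 'm \<Rightarrow> 'b::real_normed_vector) \<Rightarrow> real ^ 'm::finite \<Rightarrow> 'b" where
  "partial_deriv i F \<equiv> differential F (coord_field i)"

text \<open>\<open>christoffel g k i j p\<close> is \<open>\<Gamma>\<^sup>k\<^sub>i\<^sub>j(p)\<close> of the Levi-Civita connection of \<open>g\<close>.\<close>

definition christoffel ::
    "(real ^ 'n \<Rightarrow> real ^ 'n ^ 'n) \<Rightarrow> 'n \<Rightarrow> 'n \<Rightarrow> 'n \<Rightarrow> real ^ 'n::finite \<Rightarrow> real" where
  "christoffel g k i j p =
     (\<Sum>l\<in>UNIV. matrix_inv (g p) $ k $ l *
        (partial_deriv i (\<lambda>q. g q $ j $ l) p + partial_deriv j (\<lambda>q. g q $ i $ l) p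
           - partial_deriv l (\<lambda>q. g q $ i $ j) p)) / 2"

text \<open>\<open>pullback_cov h F X V = \<nabla>\<^sup>F\<^sub>X V\<close>, for a section \<open>V\<close> along \<open>F\<close> into the target with metric \<open>h\<close>.\<close>

definition pullback_cov ::
    "(real ^ 'n \<Rightarrow> real ^ 'n ^ 'n) \<Rightarrow> (real ^ 'm \<Rightarrow> real ^ 'n) \<Rightarrow> (real ^ 'm \<Rightarrow> real ^ 'm)
       \<Rightarrow> (real ^ 'm \<Rightarrow> real ^ 'n) \<Rightarrow> real ^ 'm::finite \<Rightarrow> real ^ 'n::finite" where
  "pullback_cov h F X V p =
     differential V X p +
     (\<chi> c. \<Sum>a\<in>UNIV. \<Sum>b\<in>UNIV. christoffel h c a b (F p) * differential F X p $ a * V p $ b)"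

definition levi_civita ::
    "(real ^ 'n \<Rightarrow> real ^ 'n ^ 'n) \<Rightarrow> (real ^ 'n \<Rightarrow> real ^ 'n) \<Rightarrow> (real ^ 'n \<Rightarrow> real ^ 'n)
       \<Rightarrow> real ^ 'n::finite \<Rightarrow> real ^ 'n" where
  "levi_civita g X Y p =
     differential Y X p +
     (\<chi> k. \<Sum>i\<in>UNIV. \<Sum>j\<in>UNIV. christoffel g k i j p * X p $ i * Y p $ j)"

text \<open>The trace of \<open>B\<close>, which has to be tensorial in its two vector field arguments.\<close>

definition metric_trace ::
    "(real ^ 'm \<Rightarrow> real ^ 'm ^ 'm)
       \<Rightarrow> ((real ^ 'm \<Rightarrow> real ^ 'm) \<Rightarrow> (real ^ 'm \<Rightarrow> real ^ 'm) \<Rightarrow> real ^ 'm \<Rightarrow> 'b::real_vector)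
       \<Rightarrow> real ^ 'm::finite \<Rightarrow> 'b" where
  "metric_trace g B p =
     (\<Sum>i\<in>UNIV. \<Sum>j\<in>UNIV. matrix_inv (g p) $ i $ j *\<^sub>R B (coord_field i) (coord_field j) p)"

definition gradient :: "(real ^ 'm \<Rightarrow> real ^ 'm ^ 'm) \<Rightarrow> (real ^ 'm \<Rightarrow> real) \<Rightarrow> real ^ 'm::finite \<Rightarrow> real ^ 'm" where
  "gradient g f p = (\<chi> i. \<Sum>j\<in>UNIV. matrix_inv (g p) $ i $ j * partial_deriv j f p)"

text \<open>The trace of the Hessian.\<close>

definition laplacian :: "(real ^ 'm \<Rightarrow> real ^ 'm ^ 'm) \<Rightarrow> (real ^ 'm \<Rightarrow> real) \<Rightarrow> real ^ 'm::finite \<Rightarrow> real" where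
  "laplacian g f =
     metric_trace g (\<lambda>X Y p. differential (differential f Y) X p - differential f (levi_civita g X Y) p)"

definition tension ::
    "(real ^ 'm \<Rightarrow> real ^ 'm ^ 'm) \<Rightarrow> (real ^ 'n \<Rightarrow> real ^ 'n ^ 'n) \<Rightarrow> (real ^ 'm \<Rightarrow> real ^ 'n)
       \<Rightarrow> real ^ 'm::finite \<Rightarrow> real ^ 'n::finite" where
  "tension g h F =
     metric_trace g
       (\<lambda>X Y p. pullback_cov h F X (differential F Y) p - differential F (levi_civita g X Y) p)"

definition lie_bracket ::
    "(real ^ 'n \<Rightarrow> real ^ 'n) \<Rightarrow> (real ^ 'n \<Rightarrow> real ^ 'n) \<Rightarrow> real ^ 'n::finite \<Rightarrow> real ^ 'n" where
  "lie_bracket X Y p = differential Y X p - differential X Y p"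

text \<open>Sign convention: \<open>R(X,Y)Z = \<nabla>\<^sub>X\<nabla>\<^sub>Y Z - \<nabla>\<^sub>Y\<nabla>\<^sub>X Z - \<nabla>\<^bsub>[X,Y]\<^esub> Z\<close>.\<close>

definition curvature ::
    "(real ^ 'n \<Rightarrow> real ^ 'n ^ 'n) \<Rightarrow> (real ^ 'n \<Rightarrow> real ^ 'n) \<Rightarrow> (real ^ 'n \<Rightarrow> real ^ 'n)
       \<Rightarrow> (real ^ 'n \<Rightarrow> real ^ 'n) \<Rightarrow> real ^ 'n::finite \<Rightarrow> real ^ 'n" where
  "curvature h X Y Z q =
     levi_civita h X (levi_civita h Y Z) q - levi_civita h Y (levi_civita h X Z) q
       - levi_civita h (lie_bracket X Y) Z q"

text \<open>
  The curvature on tangent vectors at \<open>q\<close>. As it is tensorial, any extension to vector fields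
  can be used; here it is the one with constant components.
\<close>

definition curvature_at ::
    "(real ^ 'n \<Rightarrow> real ^ 'n ^ 'n) \<Rightarrow> real ^ 'n \<Rightarrow> real ^ 'n \<Rightarrow> real ^ 'n \<Rightarrow> real ^ 'n \<Rightarrow> real ^ 'n::finite" where
  "curvature_at h q u v w = curvature h (\<lambda>_. u) (\<lambda>_. v) (\<lambda>_. w) q"

definition bitension ::
    "(real ^ 'm \<Rightarrow> real ^ 'm ^ 'm) \<Rightarrow> (real ^ 'n \<Rightarrow> real ^ 'n ^ 'n) \<Rightarrow> (real ^ 'm \<Rightarrow> real ^ 'n)
       \<Rightarrow> real ^ 'm::finite \<Rightarrow> real ^ 'n::finite" where
  "bitension g h F p =
     metric_trace g
       (\<lambda>X Y. \<lambda>p. pullback_cov h F X (pullback_cov h F Y (tension g h F)) p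
                  - pullback_cov h F (levi_civita g X Y) (tension g h F) p) p
     - metric_trace g
       (\<lambda>X Y. \<lambda>p. curvature_at h (F p) (differential F X p) (tension g h F p) (differential F Y p)) p"

definition f_biharmonic_on ::
    "(real ^ 'm) set \<Rightarrow> (real ^ 'm \<Rightarrow> real ^ 'm ^ 'm) \<Rightarrow> (real ^ 'n \<Rightarrow> real ^ 'n ^ 'n)
       \<Rightarrow> (real ^ 'm \<Rightarrow> real) \<Rightarrow> (real ^ 'm::finite \<Rightarrow> real ^ 'n::finite) \<Rightarrow> bool" where
  "f_biharmonic_on M g h f F \<longleftrightarrow>
     (\<forall>p\<in>M. f p *\<^sub>R bitension g h F p + laplacian g f p *\<^sub>R tension g h F p
              + 2 *\<^sub>R pullback_cov h F (gradient g f) (tension g h F) p = 0)"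

text \<open>\<open>dr\<^sup>2 + s(r)\<^sup>2 d\<theta>\<^sup>2\<close> in the coordinates \<open>(r, \<theta>) = (p $ 1, p $ 2)\<close>.\<close>

definition rot_metric :: "(real \<Rightarrow> real) \<Rightarrow> real ^ 2 \<Rightarrow> real ^ 2 ^ 2" where
  "rot_metric s p = vector [vector [1, 0], vector [0, (s (p $ 1))\<^sup>2]]"

definition rot_map :: "(real \<Rightarrow> real) \<Rightarrow> real \<Rightarrow> real ^ 2 \<Rightarrow> real ^ 2" where
  "rot_map \<rho> k p = vector [\<rho> (p $ 1), k * p $ 2]"

end

theory Submission
  imports Defs
begin

text \<open>
  The idea is that the tension field is radial and depends on \<open>r\<close> alone. Let \<open>\<phi>\<close> be the map, let
  \<open>(\<rho>, \<psi>)\<close> be the coordinates of the target and write \<open>\<lambda>\<close> for \<open>lam\<close>. The only nonzero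
  Christoffel symbols of \<open>dr\<^sup>2 + s\<^sup>2 d\<theta>\<^sup>2\<close> are \<open>\<Gamma>\<^sup>r\<^sub>\<theta>\<^sub>\<theta> = - s s'\<close> and \<open>\<Gamma>\<^sup>\<theta>\<^sub>r\<^sub>\<theta> = s' / s\<close>, so that
  \<open>\<tau>(\<phi>) = x(r) \<partial>\<^sub>\<rho>\<close> with the function \<open>x\<close> of the third equation (lemma \<open>tension_\<phi>\<close>). Hence
  \<open>\<nabla>\<^sub>r \<tau> = x' \<partial>\<^sub>\<rho>\<close> and \<open>\<nabla>\<^sub>\<theta> \<tau> = k x (\<lambda>' / \<lambda>) \<partial>\<^sub>\<psi>\<close>. In the trace of the second covariant derivative
  the \<open>\<theta>\<close>-direction contributes \<open>- k\<^sup>2 \<lambda>'\<^sup>2 x / \<sigma>\<^sup>2\<close>, besides the term \<open>\<sigma>' x' / \<sigma>\<close> of \<open>\<Delta>x\<close>. The trace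
  of the curvature, which is subtracted, equals \<open>k\<^sup>2 \<lambda> \<lambda>'' x / \<sigma>\<^sup>2\<close>. As \<open>\<lambda>'\<^sup>2 + \<lambda> \<lambda>'' = (\<lambda> \<lambda>')'\<close>,
  the bitension field is \<open>(\<Delta>x - k\<^sup>2 (\<lambda> \<lambda>')' x / \<sigma>\<^sup>2) \<partial>\<^sub>\<rho>\<close> (lemma \<open>bitension_\<phi>\<close>).

  In the \<open>\<partial>\<^sub>\<rho>\<close>-component of the equation for \<open>f\<close> the terms \<open>f \<Delta>x + x \<Delta>f + 2 f\<^sub>r x'\<close> are the Leibniz
  rule for \<open>\<Delta>(x f)\<close> (lemma \<open>laplacian_radial_mult\<close>), which gives the first equation of the system.
  The \<open>\<partial>\<^sub>\<psi>\<close>-component only receives the derivative of \<open>\<tau>\<close> along the angular part of \<open>grad f\<close>, which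
  gives twice the left-hand side of the second equation (lemma \<open>f_bitension_\<phi>\<close>).

  If \<open>f\<close> depends on \<open>r\<close> only, the second equation holds trivially, and the first one is the
  ordinary differential equation for \<open>y = f x\<close>, because \<open>\<Delta>y = y'' + (\<sigma>' / \<sigma>) y'\<close> for radial \<open>y\<close>.

  All fields are specified only on an open set while derivatives are total operators, so nested
  derivatives are always computed through the fact that a derivative at a point of an open set
  depends only on the values in that set.
\<close>

section \<open>Derivatives on open sets\<close>

text \<open>
  Both functions have the same derivatives at the point, and the Frechet derivative is a choice
  among these, whether there are any or not.
\<close>

lemma frechet_derivative_cong_open:
  assumes "open S" "p \<in> S" "\<And>q. q \<in> S \<Longrightarrow> F q = G q"
  shows "frechet_derivative F (at p) = frechet_derivative G (at p)"
proof -
  have "(F has_derivative D) (at p) \<longleftrightarrow> (G has_derivative D) (at p)" for D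
    using has_derivative_transform_within_open[of F D p UNIV S G]
      has_derivative_transform_within_open[of G D p UNIV S F] assms by auto
  then show ?thesis
    by (simp add: frechet_derivative_def)
qed

lemma differential_cong_open:
  assumes "open S" "p \<in> S" "\<And>q. q \<in> S \<Longrightarrow> F q = G q"
  shows "differential F X p = differential G X p"
  using frechet_derivative_cong_open[OF assms] by (simp add: differential_def)

lemma differential_eqI:
  assumes "(F has_derivative D) (at p)"
  shows "differential F X p = D (X p)"
  using frechet_derivative_at[OF assms] by (simp add: differential_def)

lemma deriv_cong_open:
  fixes u v :: "real \<Rightarrow> real"
  assumes "open S" "r \<in> S" "\<And>t. t \<in> S \<Longrightarrow> u t = v t"
  shows "deriv u r = deriv v r"
  using assms by (intro deriv_cong_ev) (auto simp: eventually_nhds)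

lemma C_diff_on_cong_open:
  assumes "open S" "\<And>q. q \<in> S \<Longrightarrow> F q = G q" "C_diff_on n S F"
  shows "C_diff_on n S G"
  using assms(2,3)
proof (induction n arbitrary: F G)
  case 0
  then show ?case using continuous_on_cong[of S S F G] by simp
next
  case (Suc n)
  have eq: "frechet_derivative F (at q) = frechet_derivative G (at q)" if "q \<in> S" for q
    using frechet_derivative_cong_open[OF \<open>open S\<close> that Suc.prems(1)] .
  have "G differentiable (at q)" if "q \<in> S" for q
    using Suc.prems \<open>open S\<close> that
    by (metis C_diff_on.simps(2) differentiable_def has_derivative_transform_within_open)
  moreover have "C_diff_on n S (\<lambda>q. frechet_derivative G (at q) v)" for v
    using Suc.prems(2) eq
    by (intro Suc.IH[of "\<lambda>q. frechet_derivative F (at q) v" "\<lambda>q. frechet_derivative G (at q) v"]) simp_all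
  ultimately show ?case by simp
qed

lemma smooth_on_differentiable: "smooth_on S F \<Longrightarrow> p \<in> S \<Longrightarrow> F differentiable (at p)"
  unfolding smooth_on_def using C_diff_on.simps(2)[of 0 S F] by blast

lemma smooth_on_partial_deriv: "smooth_on S F \<Longrightarrow> smooth_on S (partial_deriv i F)"
  unfolding smooth_on_def differential_def coord_field_def
  using C_diff_on.simps(2)[of _ S F] by blast

lemma smooth_on_deriv:
  fixes u :: "real \<Rightarrow> real"
  assumes "open S" "smooth_on S u"
  shows "smooth_on S (deriv u)"
  unfolding smooth_on_def
proof
  fix n
  have "frechet_derivative u (at t) 1 = deriv u t" if "t \<in> S" for t
  proof -
    have "(u has_real_derivative deriv u t) (at t)"
      using smooth_on_differentiable[OF assms(2) that]
      by (simp add: DERIV_deriv_iff_real_differentiable)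
    then show ?thesis
      using frechet_derivative_at[of u "(*) (deriv u t)" t]
      by (metis has_field_derivative_def mult.right_neutral)
  qed
  moreover have "C_diff_on n S (\<lambda>t. frechet_derivative u (at t) 1)"
    using assms(2) C_diff_on.simps(2)[of n S u] unfolding smooth_on_def by blast
  ultimately show "C_diff_on n S (deriv u)"
    by (intro C_diff_on_cong_open[OF assms(1), of "\<lambda>t. frechet_derivative u (at t) 1" "deriv u"]) auto
qed

text \<open>
  This is the regularity that the bitension field demands of the radial component of the tension
  field. The first derivative occurs as a witness instead of \<open>deriv u\<close>, so that each closure property
  below only exhibits the derivative given by the differentiation rule.
\<close>

definition twice_diff_on :: "real set \<Rightarrow> (real \<Rightarrow> real) \<Rightarrow> bool" where
  "twice_diff_on S u \<longleftrightarrow> (\<exists>u'. \<forall>t\<in>S. (u has_real_derivative u' t) (at t) \<and>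
     u' field_differentiable (at t))"

lemma twice_diff_onI:
  assumes "\<And>t. t \<in> S \<Longrightarrow> (u has_real_derivative u' t) (at t)"
    "\<And>t. t \<in> S \<Longrightarrow> u' field_differentiable (at t)"
  shows "twice_diff_on S u"
  using assms unfolding twice_diff_on_def by blast

lemma twice_diff_onD:
  assumes "twice_diff_on S u"
  shows "\<exists>u'. \<forall>t\<in>S. (u has_real_derivative u' t) (at t) \<and> u field_differentiable (at t) \<and>
    u' field_differentiable (at t)"
  using assms unfolding twice_diff_on_def field_differentiable_def by blast

text \<open>
  For open \<open>S\<close> the witness agrees with \<open>deriv u\<close> near each point, so that it has the same derivative.
\<close>

lemma twice_diff_on_deriv:
  assumes "open S" "twice_diff_on S u" "t \<in> S"
  shows "(u has_real_derivative deriv u t) (at t)"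
    and "(deriv u has_real_derivative deriv (deriv u) t) (at t)"
proof -
  obtain u' where u: "\<forall>t\<in>S. (u has_real_derivative u' t) (at t) \<and>
      u field_differentiable (at t) \<and> u' field_differentiable (at t)"
    using twice_diff_onD[OF assms(2)] by blast
  have eq: "deriv u t = u' t" if "t \<in> S" for t
    using u that by (auto intro: DERIV_imp_deriv)
  show "(u has_real_derivative deriv u t) (at t)"
    using u eq assms(3) by simp
  obtain d where "(u' has_real_derivative d) (at t)"
    using u assms(3) by (auto simp: field_differentiable_def)
  then have "(deriv u has_real_derivative d) (at t)"
    by (rule has_field_derivative_transform_within_open[OF _ assms(1,3)]) (simp add: eq)
  then show "(deriv u has_real_derivative deriv (deriv u) t) (at t)"
    using DERIV_imp_deriv by fastforce
qed

lemma smooth_on_imp_twice_diff_on: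
  assumes "open S" "smooth_on S u"
  shows "twice_diff_on S u"
proof (rule twice_diff_onI)
  fix t assume "t \<in> S"
  show "(u has_real_derivative deriv u t) (at t)"
    using smooth_on_differentiable[OF assms(2) \<open>t \<in> S\<close>]
    by (simp add: DERIV_deriv_iff_real_differentiable)
  have "(deriv u has_real_derivative deriv (deriv u) t) (at t)"
    using smooth_on_differentiable[OF smooth_on_deriv[OF assms] \<open>t \<in> S\<close>]
    by (simp add: DERIV_deriv_iff_real_differentiable)
  then show "deriv u field_differentiable (at t)"
    by (auto simp: field_differentiable_def)
qed

lemma twice_diff_on_const: "twice_diff_on S (\<lambda>t. c)"
  by (rule twice_diff_onI[where u' = "\<lambda>t. 0"]) auto

lemma twice_diff_on_add:
  assumes "twice_diff_on S u" "twice_diff_on S v"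
  shows "twice_diff_on S (\<lambda>t. u t + v t)"
proof -
  obtain u' where u: "\<forall>t\<in>S. (u has_real_derivative u' t) (at t) \<and>
      u field_differentiable (at t) \<and> u' field_differentiable (at t)"
    using twice_diff_onD[OF assms(1)] by blast
  obtain v' where v: "\<forall>t\<in>S. (v has_real_derivative v' t) (at t) \<and>
      v field_differentiable (at t) \<and> v' field_differentiable (at t)"
    using twice_diff_onD[OF assms(2)] by blast
  show ?thesis
    by (rule twice_diff_onI[where u' = "\<lambda>t. u' t + v' t"])
      (simp_all add: DERIV_add field_differentiable_add u v)
qed

lemma twice_diff_on_mult:
  assumes "twice_diff_on S u" "twice_diff_on S v"
  shows "twice_diff_on S (\<lambda>t. u t * v t)"
proof -
  obtain u' where u: "\<forall>t\<in>S. (u has_real_derivative u' t) (at t) \<and>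
      u field_differentiable (at t) \<and> u' field_differentiable (at t)"
    using twice_diff_onD[OF assms(1)] by blast
  obtain v' where v: "\<forall>t\<in>S. (v has_real_derivative v' t) (at t) \<and>
      v field_differentiable (at t) \<and> v' field_differentiable (at t)"
    using twice_diff_onD[OF assms(2)] by blast
  show ?thesis
    by (rule twice_diff_onI[where u' = "\<lambda>t. u' t * v t + v' t * u t"])
      (simp_all add: DERIV_mult field_differentiable_add field_differentiable_mult u v)
qed

lemma twice_diff_on_inverse:
  assumes "twice_diff_on S u" "\<And>t. t \<in> S \<Longrightarrow> u t \<noteq> 0"
  shows "twice_diff_on S (\<lambda>t. inverse (u t))"
proof -
  obtain u' where u: "\<forall>t\<in>S. (u has_real_derivative u' t) (at t) \<and>
      u field_differentiable (at t) \<and> u' field_differentiable (at t)"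
    using twice_diff_onD[OF assms(1)] by blast
  show ?thesis
    by (rule twice_diff_onI[where u' = "\<lambda>t. - (inverse (u t) * u' t * inverse (u t))"])
      (simp_all add: DERIV_inverse' field_differentiable_minus field_differentiable_mult
        field_differentiable_inverse u assms(2) del: mult_minus_left mult_minus_right)
qed

lemma twice_diff_on_compose:
  assumes "twice_diff_on K u" "twice_diff_on S v" "v ` S \<subseteq> K"
  shows "twice_diff_on S (\<lambda>t. u (v t))"
proof -
  obtain u' where u: "\<forall>t\<in>K. (u has_real_derivative u' t) (at t) \<and>
      u field_differentiable (at t) \<and> u' field_differentiable (at t)"
    using twice_diff_onD[OF assms(1)] by blast
  obtain v' where v: "\<forall>t\<in>S. (v has_real_derivative v' t) (at t) \<and>
      v field_differentiable (at t) \<and> v' field_differentiable (at t)"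
    using twice_diff_onD[OF assms(2)] by blast
  have "(\<lambda>t. u' (v t)) field_differentiable (at t)" if "t \<in> S" for t
    using field_differentiable_compose[of v t u'] u v assms(3) that
    by (auto simp: o_def)
  moreover have "((\<lambda>t. u (v t)) has_real_derivative u' (v t) * v' t) (at t)" if "t \<in> S" for t
    using DERIV_chain2[of u "u' (v t)" v t "v' t" UNIV] u v assms(3) that by blast
  ultimately show ?thesis
    by (intro twice_diff_onI[where u' = "\<lambda>t. u' (v t) * v' t"])
      (simp_all add: field_differentiable_mult v)
qed

section \<open>Derivatives of radial fields in the plane\<close>

lemma open_slab: "open I \<Longrightarrow> open {p :: real ^ 2. p $ 1 \<in> I}"
  by (auto intro!: open_vimage_vec_nth simp: vimage_def[symmetric])

lemma has_derivative_radial: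
  assumes "(u has_real_derivative u') (at (p $ 1))"
  shows "((\<lambda>q :: real ^ 2. u (q $ 1)) has_derivative (\<lambda>h. u' * h $ 1)) (at p)"
  using assms[unfolded has_field_derivative_def]
  by (intro has_derivative_compose[of "\<lambda>q. q $ 1" "\<lambda>h. h $ 1", where g = u])
    (auto intro: bounded_linear_imp_has_derivative)

lemma differential_radial:
  assumes "(u has_real_derivative u') (at (p $ 1))"
  shows "differential (\<lambda>q :: real ^ 2. u (q $ 1)) X p = u' * X p $ 1"
  using has_derivative_radial[OF assms] by (rule differential_eqI)

lemma vector_2_eq_axis: "(vector [a, b] :: real ^ 2) = a *\<^sub>R axis 1 1 + b *\<^sub>R axis 2 1"
  by (simp add: vec_eq_iff forall_2 axis_def)

lemma has_derivative_vector_2: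
  fixes a b :: "'a::real_normed_vector \<Rightarrow> real"
  assumes "(a has_derivative a') F" "(b has_derivative b') F"
  shows "((\<lambda>q. vector [a q, b q] :: real ^ 2) has_derivative (\<lambda>h. vector [a' h, b' h])) F"
  unfolding vector_2_eq_axis by (intro derivative_intros assms)

lemma differential_vector_radial:
  assumes "(a has_real_derivative a') (at (p $ 1))" "(b has_real_derivative b') (at (p $ 1))"
  shows "differential (\<lambda>q :: real ^ 2. vector [a (q $ 1), b (q $ 1)] :: real ^ 2) X p =
    vector [a' * X p $ 1, b' * X p $ 1]"
  by (intro differential_eqI has_derivative_vector_2 has_derivative_radial assms)

lemma differential_add:
  assumes "F differentiable (at p)" "G differentiable (at p)"
  shows "differential (\<lambda>q. F q + G q) X p = differential F X p + differential G X p"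
  using assms unfolding differential_def frechet_derivative_works
  by (metis frechet_derivative_at has_derivative_add)

lemma has_real_derivative_slice:
  fixes f :: "real ^ 2 \<Rightarrow> real"
  assumes "f differentiable (at (vector [r, c]))"
  shows "((\<lambda>t. f (vector [t, c])) has_real_derivative partial_deriv 1 f (vector [r, c])) (at r)"
proof -
  let ?D = "frechet_derivative f (at (vector [r, c]))"
  have "((\<lambda>t. vector [t, c] :: real ^ 2) has_derivative (\<lambda>h. vector [h, 0])) (at r)"
    by (intro has_derivative_vector_2 derivative_intros)
  then have "((\<lambda>t. f (vector [t, c])) has_derivative (\<lambda>h. ?D (vector [h, 0]))) (at r)"
    by (rule has_derivative_compose) (fact assms[unfolded frechet_derivative_works])
  moreover have "?D (vector [h, 0]) = partial_deriv 1 f (vector [r, c]) * h" for h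
    using linear_frechet_derivative[OF assms]
    by (simp add: vector_2_eq_axis linear_cmul differential_def coord_field_def)
  ultimately show ?thesis
    by (simp add: has_field_derivative_def)
qed

section \<open>Connection and curvature of a rotationally symmetric metric\<close>

lemma matrix_inv_eqI:
  fixes A B :: "real ^ 'n ^ 'n"
  assumes "A ** B = mat 1" "B ** A = mat 1"
  shows "matrix_inv A = B"
proof -
  have "A ** matrix_inv A = mat 1 \<and> matrix_inv A ** A = mat 1"
    unfolding matrix_inv_def by (rule someI) (use assms in simp)
  then show ?thesis
    using assms by (metis matrix_mul_assoc matrix_mul_lid matrix_mul_rid)
qed

lemma matrix_inv_rot_metric:
  assumes "s (p $ 1) \<noteq> 0"
  shows "matrix_inv (rot_metric s p) = vector [vector [1, 0], vector [0, 1 / (s (p $ 1))\<^sup>2]]"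
  using assms
  by (intro matrix_inv_eqI)
    (auto simp: rot_metric_def matrix_matrix_mult_def vec_eq_iff forall_2 sum_2 mat_def)

lemma metric_trace_rot_metric:
  assumes "s (p $ 1) \<noteq> 0"
  shows "metric_trace (rot_metric s) B p =
    B (coord_field 1) (coord_field 1) p + (1 / (s (p $ 1))\<^sup>2) *\<^sub>R B (coord_field 2) (coord_field 2) p"
  using assms by (simp add: metric_trace_def matrix_inv_rot_metric sum_2)

lemma gradient_rot_metric:
  assumes "s (p $ 1) \<noteq> 0"
  shows "gradient (rot_metric s) f p = vector [partial_deriv 1 f p, partial_deriv 2 f p / (s (p $ 1))\<^sup>2]"
  using assms by (simp add: gradient_def matrix_inv_rot_metric vec_eq_iff forall_2 sum_2)

lemma partial_deriv_rot_metric: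
  assumes "(s has_real_derivative s') (at (p $ 1))"
  shows "partial_deriv l (\<lambda>q. rot_metric s q $ i $ j) p =
    (if l = 1 \<and> i = 2 \<and> j = 2 then 2 * s (p $ 1) * s' else 0)"
proof -
  have "((\<lambda>t. (s t)\<^sup>2) has_real_derivative 2 * s (p $ 1) * s') (at (p $ 1))"
    using assms by (auto intro!: derivative_eq_intros)
  then have "partial_deriv l (\<lambda>q. (s (q $ 1))\<^sup>2) p = 2 * s (p $ 1) * s' * axis l 1 $ 1"
    by (subst differential_radial) (auto simp: coord_field_def)
  moreover have "partial_deriv l (\<lambda>q. c) p = 0" for c :: real
    by (subst differential_eqI) (auto intro: derivative_intros)
  ultimately show ?thesis
    using exhaust_2[of i] exhaust_2[of j] exhaust_2[of l]
    by (auto simp: rot_metric_def axis_def)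
qed

lemma christoffel_rot_metric:
  assumes "(s has_real_derivative s') (at (p $ 1))" "s (p $ 1) \<noteq> 0"
  shows "christoffel (rot_metric s) c i j p =
    (if c = 1 \<and> i = 2 \<and> j = 2 then - s (p $ 1) * s'
     else if c = 2 \<and> i \<noteq> j then s' / s (p $ 1) else 0)"
  using exhaust_2[of i] exhaust_2[of j] exhaust_2[of c] assms(2)
  by (auto simp: christoffel_def partial_deriv_rot_metric[OF assms(1)] matrix_inv_rot_metric sum_2
    power2_eq_square)

lemma levi_civita_rot_metric:
  assumes "(s has_real_derivative s') (at (p $ 1))" "s (p $ 1) \<noteq> 0"
  shows "levi_civita (rot_metric s) X Y p = differential Y X p +
    vector [- s (p $ 1) * s' * (X p $ 2 * Y p $ 2),
            s' / s (p $ 1) * (X p $ 1 * Y p $ 2 + X p $ 2 * Y p $ 1)]"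
  by (simp add: levi_civita_def christoffel_rot_metric[OF assms] vec_eq_iff forall_2 sum_2 algebra_simps)

lemma pullback_cov_rot_metric:
  assumes "(s has_real_derivative s') (at (F p $ 1))" "s (F p $ 1) \<noteq> 0"
  shows "pullback_cov (rot_metric s) F X V p = differential V X p +
    vector [- s (F p $ 1) * s' * (differential F X p $ 2 * V p $ 2),
            s' / s (F p $ 1) * (differential F X p $ 1 * V p $ 2 + differential F X p $ 2 * V p $ 1)]"
  by (simp add: pullback_cov_def christoffel_rot_metric[OF assms] vec_eq_iff forall_2 sum_2 algebra_simps)

lemma differential_const: "differential (\<lambda>_. c) X p = 0"
  by (subst differential_eqI) (auto intro: derivative_intros)

lemma differential_zero_field: "F differentiable (at p) \<Longrightarrow> X p = 0 \<Longrightarrow> differential F X p = 0"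
  by (simp add: differential_def linear_0 linear_frechet_derivative)

lemma levi_civita_coord_rot_metric:
  assumes "(s has_real_derivative s') (at (p $ 1))" "s (p $ 1) \<noteq> 0"
  shows "levi_civita (rot_metric s) (coord_field 1) (coord_field 1) p = 0"
    and "levi_civita (rot_metric s) (coord_field 2) (coord_field 2) p = vector [- s (p $ 1) * s', 0]"
  using levi_civita_rot_metric[OF assms]
  by (simp_all add: coord_field_def differential_const vec_eq_iff forall_2 axis_def)

text \<open>
  The right-hand side is \<open>\<kappa> (\<langle>v, w\<rangle> u - \<langle>u, w\<rangle> v)\<close> for the Gauss curvature \<open>\<kappa> = - s'' / s\<close>,
  written in components.
\<close>

lemma curvature_at_rot_metric:
  assumes "open K" "twice_diff_on K s" "\<And>t. t \<in> K \<Longrightarrow> s t \<noteq> 0" "q $ 1 \<in> K"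
  shows "curvature_at (rot_metric s) q u v w = (u $ 1 * v $ 2 - u $ 2 * v $ 1) *\<^sub>R
    vector [- s (q $ 1) * deriv (deriv s) (q $ 1) * w $ 2, deriv (deriv s) (q $ 1) / s (q $ 1) * w $ 1]"
proof -
  note s = twice_diff_on_deriv[OF assms(1,2)]
  \<comment> \<open>The inner covariant derivatives are radial fields, so the outer ones only need their \<open>r\<close>-derivatives.\<close>
  define Z where "Z v w = levi_civita (rot_metric s) (\<lambda>_. v) (\<lambda>_. w)" for v w :: "real ^ 2"
  have Z: "Z v w p = vector [- s (p $ 1) * deriv s (p $ 1) * (v $ 2 * w $ 2),
      deriv s (p $ 1) / s (p $ 1) * (v $ 1 * w $ 2 + v $ 2 * w $ 1)]" if "p $ 1 \<in> K" for v w p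
    unfolding Z_def levi_civita_rot_metric[OF s(1)[OF that] assms(3)[OF that]]
    by (simp add: differential_const)
  have dZ: "differential (Z v w) X q =
     vector [- ((deriv s (q $ 1))\<^sup>2 + s (q $ 1) * deriv (deriv s) (q $ 1)) * (v $ 2 * w $ 2) * X q $ 1,
      (deriv (deriv s) (q $ 1) * s (q $ 1) - (deriv s (q $ 1))\<^sup>2) / (s (q $ 1))\<^sup>2 *
        (v $ 1 * w $ 2 + v $ 2 * w $ 1) * X q $ 1]" for v w X
  proof -
    have "differential (Z v w) X q = differential (\<lambda>p.
      vector [- s (p $ 1) * deriv s (p $ 1) * (v $ 2 * w $ 2),
      deriv s (p $ 1) / s (p $ 1) * (v $ 1 * w $ 2 + v $ 2 * w $ 1)]) X q"
      using assms(1,4) Z by (intro differential_cong_open[OF open_slab[of K]]) auto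
    also have "\<dots> = vector [- ((deriv s (q $ 1))\<^sup>2 + s (q $ 1) * deriv (deriv s) (q $ 1)) * (v $ 2 * w $ 2) * X q $ 1,
      (deriv (deriv s) (q $ 1) * s (q $ 1) - (deriv s (q $ 1))\<^sup>2) / (s (q $ 1))\<^sup>2 *
        (v $ 1 * w $ 2 + v $ 2 * w $ 1) * X q $ 1]"
      using assms(3,4) s
      by (intro differential_vector_radial)
        (auto intro!: derivative_eq_intros simp: power2_eq_square algebra_simps
          diff_divide_distrib add_divide_distrib)
    finally show ?thesis .
  qed
  have br: "levi_civita (rot_metric s) (lie_bracket (\<lambda>_. u) (\<lambda>_. v)) (\<lambda>_. w) q = 0"
    using levi_civita_rot_metric[OF s(1) assms(3), OF assms(4,4)]
    by (simp add: lie_bracket_def differential_const vec_eq_iff forall_2)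
  have outer: "levi_civita (rot_metric s) (\<lambda>_. u) (Z v w) q = differential (Z v w) (\<lambda>_. u) q +
    vector [- s (q $ 1) * deriv s (q $ 1) * (u $ 2 * Z v w q $ 2),
            deriv s (q $ 1) / s (q $ 1) * (u $ 1 * Z v w q $ 2 + u $ 2 * Z v w q $ 1)]" for u v w
    using levi_civita_rot_metric[OF s(1) assms(3), OF assms(4,4)] .
  have "curvature_at (rot_metric s) q u v w =
    levi_civita (rot_metric s) (\<lambda>_. u) (Z v w) q - levi_civita (rot_metric s) (\<lambda>_. v) (Z u w) q"
    unfolding curvature_at_def curvature_def br Z_def by simp
  also have "\<dots> = (u $ 1 * v $ 2 - u $ 2 * v $ 1) *\<^sub>R
    vector [- s (q $ 1) * deriv (deriv s) (q $ 1) * w $ 2, deriv (deriv s) (q $ 1) / s (q $ 1) * w $ 1]"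
    unfolding outer dZ Z[OF assms(4)] using assms(3)[OF assms(4)]
    by (simp add: vec_eq_iff forall_2 field_simps power2_eq_square)
  finally show ?thesis .
qed

section \<open>The Laplacian\<close>

lemma laplacian_rot_metric:
  assumes "(s has_real_derivative s') (at (p $ 1))" "s (p $ 1) \<noteq> 0" "f differentiable (at p)"
  shows "laplacian (rot_metric s) f p = partial_deriv 1 (partial_deriv 1 f) p +
    (partial_deriv 2 (partial_deriv 2 f) p + s (p $ 1) * s' * partial_deriv 1 f p) / (s (p $ 1))\<^sup>2"
proof -
  have "linear (frechet_derivative f (at p))"
    using assms(3) by (rule linear_frechet_derivative)
  then have "differential f (levi_civita (rot_metric s) (coord_field 2) (coord_field 2)) p =
    - s (p $ 1) * s' * partial_deriv 1 f p"
    unfolding differential_def levi_civita_coord_rot_metric(2)[OF assms(1,2)]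
    by (simp add: vector_2_eq_axis coord_field_def linear_cmul linear_add linear_neg)
  moreover have "differential f (levi_civita (rot_metric s) (coord_field 1) (coord_field 1)) p = 0"
    by (intro differential_zero_field assms levi_civita_coord_rot_metric[OF assms(1,2)])
  ultimately show ?thesis
    unfolding laplacian_def using assms(2) by (simp add: metric_trace_rot_metric field_simps)
qed

lemma partial_deriv_radial_mult:
  fixes f :: "real ^ 2 \<Rightarrow> real"
  assumes "(u has_real_derivative u') (at (p $ 1))" "f differentiable (at p)"
  shows "partial_deriv i (\<lambda>q. u (q $ 1) * f q) p =
    (if i = 1 then u' * f p else 0) + u (p $ 1) * partial_deriv i f p"
proof -
  note u = has_derivative_radial[OF assms(1)]
  have f: "(f has_derivative frechet_derivative f (at p)) (at p)"
    using assms(2) by (simp add: frechet_derivative_works)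
  show ?thesis
    by (subst differential_eqI[OF has_derivative_mult[OF u f]])
      (simp add: coord_field_def axis_def differential_def)
qed

lemma differentiable_radial_mult:
  fixes f :: "real ^ 2 \<Rightarrow> real"
  assumes "(u has_real_derivative u') (at (p $ 1))" "f differentiable (at p)"
  shows "(\<lambda>q. u (q $ 1) * f q) differentiable (at p)"
  using has_derivative_radial[OF assms(1)] assms(2)
  by (intro differentiable_mult) (auto simp: differentiable_def)

text \<open>
  The Leibniz rule \<open>\<Delta>(u f) = u \<Delta>f + 2 \<langle>grad u, grad f\<rangle> + f \<Delta>u\<close> for radial \<open>u\<close>, whose gradient is
  \<open>u' \<partial>\<^sub>r\<close>. The product may be replaced by any function \<open>F\<close> that agrees with it on \<open>M\<close>.
\<close>

lemma laplacian_radial_mult: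
  assumes "open I" "twice_diff_on I s" "\<And>t. t \<in> I \<Longrightarrow> s t \<noteq> 0"
    and "twice_diff_on I u" "open M" "smooth_on M f" "p \<in> M" "M \<subseteq> {q. q $ 1 \<in> I}"
    and "\<And>q. q \<in> M \<Longrightarrow> F q = u (q $ 1) * f q"
  shows "laplacian (rot_metric s) F p = u (p $ 1) * laplacian (rot_metric s) f p
    + 2 * deriv u (p $ 1) * partial_deriv 1 f p
    + (deriv (deriv u) (p $ 1) + deriv s (p $ 1) / s (p $ 1) * deriv u (p $ 1)) * f p"
proof -
  note s = twice_diff_on_deriv[OF assms(1,2)] and u = twice_diff_on_deriv[OF assms(1,4)]
  have inI: "q $ 1 \<in> I" if "q \<in> M" for q using that assms(8) by auto
  have f: "f differentiable (at q)" "partial_deriv i f differentiable (at q)" if "q \<in> M" for q i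
    using assms(6) that by (auto intro: smooth_on_differentiable smooth_on_partial_deriv)
  have d1: "partial_deriv i F q = (if i = 1 then deriv u (q $ 1) * f q else 0)
      + u (q $ 1) * partial_deriv i f q" if "q \<in> M" for i q
    using partial_deriv_radial_mult[OF u(1)[OF inI[OF that]] f(1)[OF that]]
      differential_cong_open[OF assms(5) that assms(9)] by simp
  have F: "F differentiable (at p)"
  proof -
    have "(\<lambda>q. u (q $ 1) * f q) differentiable (at p)"
      using differentiable_radial_mult[OF u(1)[OF inI] f(1), OF assms(7,7)] .
    then show ?thesis
      using assms(5,7,9) has_derivative_transform_within_open[of _ _ p UNIV M F]
      unfolding differentiable_def by (metis (no_types, lifting))
  qed
  have d2: "partial_deriv i (partial_deriv i F) p =
      (if i = 1 then deriv (deriv u) (p $ 1) * f p + 2 * deriv u (p $ 1) * partial_deriv 1 f p else 0)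
      + u (p $ 1) * partial_deriv i (partial_deriv i f) p" for i
  proof -
    have "partial_deriv i (partial_deriv i F) p =
      partial_deriv i (\<lambda>q. (if i = 1 then deriv u (q $ 1) * f q else 0) + u (q $ 1) * partial_deriv i f q) p"
      using d1 by (intro differential_cong_open[OF assms(5,7)]) simp
    also have "\<dots> = partial_deriv i (\<lambda>q. if i = 1 then deriv u (q $ 1) * f q else 0) p
      + partial_deriv i (\<lambda>q. u (q $ 1) * partial_deriv i f q) p"
      using differentiable_radial_mult[OF u(2)[OF inI] f(1), OF assms(7,7)]
        differentiable_radial_mult[OF u(1)[OF inI] f(2), OF assms(7,7), of i]
      by (intro differential_add; cases "i = 1") auto
    also have "partial_deriv i (\<lambda>q. if i = 1 then deriv u (q $ 1) * f q else 0) p =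
      (if i = 1 then deriv (deriv u) (p $ 1) * f p + deriv u (p $ 1) * partial_deriv 1 f p else 0)"
      using partial_deriv_radial_mult[OF u(2)[OF inI] f(1), OF assms(7,7)]
      by (simp add: differential_const)
    also have "partial_deriv i (\<lambda>q. u (q $ 1) * partial_deriv i f q) p =
      (if i = 1 then deriv u (p $ 1) * partial_deriv 1 f p else 0) + u (p $ 1) * partial_deriv i (partial_deriv i f) p"
      using partial_deriv_radial_mult[OF u(1)[OF inI] f(2), OF assms(7,7)] by simp
    finally show ?thesis by simp
  qed
  have nz: "s (p $ 1) \<noteq> 0" using assms(3) inI assms(7) by blast
  show ?thesis
    unfolding laplacian_rot_metric[OF s(1)[OF inI[OF assms(7)]] nz F]
      laplacian_rot_metric[OF s(1)[OF inI[OF assms(7)]] nz f(1)[OF assms(7)]] d2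
    using nz d1[OF assms(7), of 1] by (simp add: field_simps power2_eq_square)
qed

lemma laplacian_radial:
  assumes "open I" "twice_diff_on I s" "\<And>t. t \<in> I \<Longrightarrow> s t \<noteq> 0"
    and "twice_diff_on I u" "p $ 1 \<in> I"
  shows "laplacian (rot_metric s) (\<lambda>q. u (q $ 1)) p =
    deriv (deriv u) (p $ 1) + deriv s (p $ 1) / s (p $ 1) * deriv u (p $ 1)"
proof -
  note s = twice_diff_on_deriv[OF assms(1,2)] and u = twice_diff_on_deriv[OF assms(1,4)]
  have d1: "partial_deriv i (\<lambda>q. u (q $ 1)) q = (if i = 1 then deriv u (q $ 1) else 0)"
    if "q $ 1 \<in> I" for i :: 2 and q
    using differential_radial[OF u(1)[OF that]] by (simp add: coord_field_def axis_def)
  have "partial_deriv i (partial_deriv i (\<lambda>q. u (q $ 1))) p =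
      partial_deriv i (\<lambda>q. if i = 1 then deriv u (q $ 1) else 0) p" for i
    using assms(5) d1 by (intro differential_cong_open[OF open_slab[OF assms(1)]]) auto
  also have "\<dots> i = (if i = 1 then deriv (deriv u) (p $ 1) else 0)" for i
    using differential_radial[OF u(2)[OF assms(5)]]
    by (simp add: coord_field_def axis_def differential_const)
  finally have d2: "partial_deriv i (partial_deriv i (\<lambda>q. u (q $ 1))) p =
    (if i = 1 then deriv (deriv u) (p $ 1) else 0)" for i .
  have "(\<lambda>q. u (q $ 1)) differentiable (at p)"
    using has_derivative_radial[OF u(1)[OF assms(5)]] by (auto simp: differentiable_def)
  then show ?thesis
    using laplacian_rot_metric[OF s(1)[OF assms(5)] assms(3)[OF assms(5)]] assms(3)[OF assms(5)]
    by (simp add: d2 d1[OF assms(5)] power2_eq_square)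
qed

section \<open>Rotationally symmetric maps\<close>

lemma differential_rot_map:
  assumes "(\<rho> has_real_derivative \<rho>') (at (p $ 1))"
  shows "differential (rot_map \<rho> k) X p = vector [\<rho>' * X p $ 1, k * X p $ 2]"
proof -
  have "((\<lambda>q. vector [\<rho> (q $ 1), k * q $ 2] :: real ^ 2) has_derivative
      (\<lambda>h. vector [\<rho>' * h $ 1, k * h $ 2])) (at p)"
    by (intro has_derivative_vector_2 has_derivative_radial assms has_derivative_mult_right
      bounded_linear_imp_has_derivative bounded_linear_vec_nth)
  then show ?thesis
    using differential_eqI by (simp add: rot_map_def[abs_def])
qed

text \<open>
  All data are radial: by rotational symmetry the components of the tension and the bitension field
  do not depend on the angle, so the fields can be computed on the whole slab over \<open>I\<close>.
\<close>

locale rotational_map =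
  fixes I K :: "real set" and \<sigma> lam \<rho> :: "real \<Rightarrow> real" and k :: real
  assumes I: "open I" and K: "open K"
    and \<sigma>: "smooth_on I \<sigma>" "\<And>r. r \<in> I \<Longrightarrow> \<sigma> r > 0"
    and lam: "smooth_on K lam" "\<And>s. s \<in> K \<Longrightarrow> lam s > 0"
    and \<rho>: "smooth_on I \<rho>" "\<rho> ` I \<subseteq> K"
begin

abbreviation "g \<equiv> rot_metric \<sigma>"
abbreviation "h \<equiv> rot_metric lam"
abbreviation "\<phi> \<equiv> rot_map \<rho> k"

text \<open>
  The \<open>\<partial>\<^sub>\<rho>\<close>-component of the tension field, called \<open>x\<close> in the systems of equations.
\<close>

definition tau :: "real \<Rightarrow> real" where
  "tau r = deriv (deriv \<rho>) r + deriv \<sigma> r / \<sigma> r * deriv \<rho> r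
     - k\<^sup>2 * lam (\<rho> r) * deriv lam (\<rho> r) / (\<sigma> r)\<^sup>2"

lemma twice_diff:
  "twice_diff_on I \<sigma>" "twice_diff_on I (deriv \<sigma>)"
  "twice_diff_on K lam" "twice_diff_on K (deriv lam)"
  "twice_diff_on I \<rho>" "twice_diff_on I (deriv \<rho>)" "twice_diff_on I (deriv (deriv \<rho>))"
  using I K \<sigma> lam \<rho> by (simp_all add: smooth_on_imp_twice_diff_on smooth_on_deriv)

lemma twice_diff_lam_\<rho>:
  "twice_diff_on I (\<lambda>r. lam (\<rho> r))" "twice_diff_on I (\<lambda>r. deriv lam (\<rho> r))"
  using twice_diff twice_diff_on_compose[OF _ _ \<rho>(2)] by auto

lemma \<rho>_in: "r \<in> I \<Longrightarrow> \<rho> r \<in> K"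
  using \<rho>(2) by auto

lemma nonzero: "r \<in> I \<Longrightarrow> \<sigma> r \<noteq> 0" "s \<in> K \<Longrightarrow> lam s \<noteq> 0"
  using \<sigma>(2) lam(2) by force+

lemma twice_diff_on_tau: "twice_diff_on I tau"
proof -
  have "twice_diff_on I (\<lambda>r. deriv (deriv \<rho>) r + deriv \<sigma> r * inverse (\<sigma> r) * deriv \<rho> r
     + (- k\<^sup>2) * (lam (\<rho> r) * (deriv lam (\<rho> r) * (inverse (\<sigma> r) * inverse (\<sigma> r)))))"
    by (intro twice_diff_on_add twice_diff_on_mult twice_diff_on_const twice_diff_on_inverse
      twice_diff twice_diff_lam_\<rho> nonzero)
  also have "(\<lambda>r. deriv (deriv \<rho>) r + deriv \<sigma> r * inverse (\<sigma> r) * deriv \<rho> r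
     + (- k\<^sup>2) * (lam (\<rho> r) * (deriv lam (\<rho> r) * (inverse (\<sigma> r) * inverse (\<sigma> r))))) = tau"
    by (rule ext) (simp add: tau_def field_simps power2_eq_square)
  finally show ?thesis .
qed

lemmas \<sigma>_deriv = twice_diff_on_deriv[OF I twice_diff(1)]
lemmas lam_deriv = twice_diff_on_deriv[OF K twice_diff(3)]
lemmas \<rho>_deriv = twice_diff_on_deriv[OF I twice_diff(5)]
lemmas tau_deriv = twice_diff_on_deriv[OF I twice_diff_on_tau]

lemma differential_\<phi>:
  "p $ 1 \<in> I \<Longrightarrow> differential \<phi> X p = vector [deriv \<rho> (p $ 1) * X p $ 1, k * X p $ 2]"
  using differential_rot_map[OF \<rho>_deriv(1)] .

lemma pullback_cov_\<phi>:
  assumes "p $ 1 \<in> I"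
  shows "pullback_cov h \<phi> X V p = differential V X p +
    vector [- lam (\<rho> (p $ 1)) * deriv lam (\<rho> (p $ 1)) * (k * X p $ 2 * V p $ 2),
      deriv lam (\<rho> (p $ 1)) / lam (\<rho> (p $ 1)) *
        (deriv \<rho> (p $ 1) * X p $ 1 * V p $ 2 + k * X p $ 2 * V p $ 1)]"
  using pullback_cov_rot_metric[of lam "deriv lam (\<rho> (p $ 1))" \<phi> p X V]
    lam_deriv(1)[OF \<rho>_in[OF assms]] nonzero(2)[OF \<rho>_in[OF assms]]
  by (simp add: differential_\<phi>[OF assms]) (simp add: rot_map_def)

text \<open>
  All fields along \<open>\<phi>\<close> that are differentiated below have components that depend on \<open>r\<close> alone.
  For such a field the \<open>\<theta>\<close>-derivative of the components drops out and only Christoffel symbols of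
  the target remain in the direction \<open>\<partial>\<^sub>\<theta>\<close>.
\<close>

lemma pullback_cov_\<phi>_radial:
  assumes "p $ 1 \<in> I" "\<And>q. q $ 1 \<in> I \<Longrightarrow> V q = vector [a (q $ 1), b (q $ 1)]"
    and "(a has_real_derivative a') (at (p $ 1))" "(b has_real_derivative b') (at (p $ 1))"
  shows "pullback_cov h \<phi> X V p =
    vector [a' * X p $ 1 - lam (\<rho> (p $ 1)) * deriv lam (\<rho> (p $ 1)) * k * X p $ 2 * b (p $ 1),
      b' * X p $ 1 + deriv lam (\<rho> (p $ 1)) / lam (\<rho> (p $ 1)) *
        (deriv \<rho> (p $ 1) * X p $ 1 * b (p $ 1) + k * X p $ 2 * a (p $ 1))]"
proof -
  have "differential V X p = vector [a' * X p $ 1, b' * X p $ 1]"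
    using differential_cong_open[OF open_slab[OF I], of p V] assms
      differential_vector_radial[OF assms(3,4)] by simp
  then show ?thesis
    by (simp add: pullback_cov_\<phi>[OF assms(1)] assms(2)[OF assms(1)] vec_eq_iff forall_2 algebra_simps)
qed

lemma tension_\<phi>:
  assumes "p $ 1 \<in> I"
  shows "tension g h \<phi> p = vector [tau (p $ 1), 0]"
proof -
  have lc: "levi_civita g (coord_field 1) (coord_field 1) p = 0"
    "levi_civita g (coord_field 2) (coord_field 2) p = vector [- \<sigma> (p $ 1) * deriv \<sigma> (p $ 1), 0]"
    using levi_civita_coord_rot_metric[OF \<sigma>_deriv(1) nonzero(1), OF assms assms] by auto
  have 1: "pullback_cov h \<phi> (coord_field 1) (differential \<phi> (coord_field 1)) p =
      vector [deriv (deriv \<rho>) (p $ 1), 0]"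
    using pullback_cov_\<phi>_radial[where a = "deriv \<rho>" and b = "\<lambda>_. 0" and b' = 0
        and V = "differential \<phi> (coord_field 1)", OF assms _ \<rho>_deriv(2)[OF assms]]
    by (simp add: differential_\<phi> coord_field_def axis_def)
  have 2: "pullback_cov h \<phi> (coord_field 2) (differential \<phi> (coord_field 2)) p =
      vector [- k\<^sup>2 * lam (\<rho> (p $ 1)) * deriv lam (\<rho> (p $ 1)), 0]"
    using pullback_cov_\<phi>_radial[where a = "\<lambda>_. 0" and a' = 0 and b = "\<lambda>_. k" and b' = 0
        and V = "differential \<phi> (coord_field 2)", OF assms]
    by (simp add: differential_\<phi> coord_field_def axis_def power2_eq_square vec_eq_iff forall_2)
  show ?thesis
    unfolding tension_def metric_trace_rot_metric[of \<sigma> p, OF nonzero(1)[OF assms]] 1 2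
      differential_\<phi>[OF assms] lc
    using nonzero(1)[OF assms]
    by (simp add: vec_eq_iff forall_2 tau_def field_simps power2_eq_square)
qed

lemma pullback_cov_tension_\<phi>:
  assumes "p $ 1 \<in> I"
  shows "pullback_cov h \<phi> X (tension g h \<phi>) p = vector [deriv tau (p $ 1) * X p $ 1,
    deriv lam (\<rho> (p $ 1)) / lam (\<rho> (p $ 1)) * k * tau (p $ 1) * X p $ 2]"
  using pullback_cov_\<phi>_radial[where b = "\<lambda>_. 0" and b' = 0, OF assms tension_\<phi> tau_deriv(1)[OF assms]]
  by (simp add: mult_ac)

text \<open>
  The second covariant derivative in the direction \<open>\<partial>\<^sub>\<theta>\<close> yields \<open>\<lambda>'\<^sup>2\<close> and the curvature yields
  \<open>\<lambda> \<lambda>''\<close>; together they form \<open>(\<lambda> \<lambda>')'\<close>.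
\<close>

lemma bitension_\<phi>:
  assumes "p $ 1 \<in> I"
  shows "bitension g h \<phi> p = vector [deriv (deriv tau) (p $ 1)
      + deriv \<sigma> (p $ 1) / \<sigma> (p $ 1) * deriv tau (p $ 1)
      - k\<^sup>2 * deriv (\<lambda>s. lam s * deriv lam s) (\<rho> (p $ 1)) / (\<sigma> (p $ 1))\<^sup>2 * tau (p $ 1), 0]"
proof -
  let ?r = "p $ 1" and ?t = "tension g h \<phi>"
  \<comment> \<open>\<open>b\<close> is the angular component of \<open>\<nabla>\<^sub>\<theta> \<tau>\<close>; \<open>inverse\<close> replaces division to fit the closure rules.\<close>
  define b where "b r = k * (deriv lam (\<rho> r) * (inverse (lam (\<rho> r)) * tau r))" for r
  have "twice_diff_on I b" unfolding b_def
    by (intro twice_diff_on_mult twice_diff_on_const twice_diff_on_inverse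
      twice_diff_on_tau twice_diff_lam_\<rho> nonzero \<rho>_in)
  then have b: "(b has_real_derivative deriv b ?r) (at ?r)"
    using twice_diff_on_deriv[OF I _ assms] by blast
  have lc: "levi_civita g (coord_field 1) (coord_field 1) p = 0"
    "levi_civita g (coord_field 2) (coord_field 2) p = vector [- \<sigma> ?r * deriv \<sigma> ?r, 0]"
    using levi_civita_coord_rot_metric[OF \<sigma>_deriv(1) nonzero(1), OF assms assms] by auto
  have 1: "pullback_cov h \<phi> (coord_field 1) (pullback_cov h \<phi> (coord_field 1) ?t) p =
      vector [deriv (deriv tau) ?r, 0]"
    using pullback_cov_\<phi>_radial[where a = "deriv tau" and b = "\<lambda>_. 0" and b' = 0
        and V = "pullback_cov h \<phi> (coord_field 1) ?t", OF assms _ tau_deriv(2)[OF assms]]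
    by (simp add: pullback_cov_tension_\<phi> coord_field_def axis_def)
  have 2: "pullback_cov h \<phi> (coord_field 2) (pullback_cov h \<phi> (coord_field 2) ?t) p =
      vector [- k\<^sup>2 * (deriv lam (\<rho> ?r))\<^sup>2 * tau ?r, 0]"
    using pullback_cov_\<phi>_radial[where a = "\<lambda>_. 0" and a' = 0 and b = b
        and V = "pullback_cov h \<phi> (coord_field 2) ?t" and X = "coord_field 2", OF assms _ _ b]
      nonzero(2)[OF \<rho>_in[OF assms]]
    by (simp add: pullback_cov_tension_\<phi> coord_field_def axis_def power2_eq_square vec_eq_iff
      forall_2 b_def field_simps)
  have curv: "curvature_at h (\<phi> p) u v w = (u $ 1 * v $ 2 - u $ 2 * v $ 1) *\<^sub>R
    vector [- lam (\<rho> ?r) * deriv (deriv lam) (\<rho> ?r) * w $ 2,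
      deriv (deriv lam) (\<rho> ?r) / lam (\<rho> ?r) * w $ 1]" for u v w
    using curvature_at_rot_metric[OF K twice_diff(3) nonzero(2), of "\<phi> p"] \<rho>_in[OF assms]
    by (simp add: rot_map_def)
  have "((\<lambda>s. lam s * deriv lam s) has_real_derivative
      deriv lam (\<rho> ?r) * deriv lam (\<rho> ?r) + deriv (deriv lam) (\<rho> ?r) * lam (\<rho> ?r)) (at (\<rho> ?r))"
    by (intro DERIV_mult lam_deriv \<rho>_in assms)
  then have lam2: "deriv (\<lambda>s. lam s * deriv lam s) (\<rho> ?r) =
      deriv lam (\<rho> ?r) * deriv lam (\<rho> ?r) + deriv (deriv lam) (\<rho> ?r) * lam (\<rho> ?r)"
    by (rule DERIV_imp_deriv)
  show ?thesis
    unfolding bitension_def metric_trace_rot_metric[of \<sigma> p, OF nonzero(1)[OF assms]] 1 2 curv lam2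
      pullback_cov_tension_\<phi>[OF assms] lc tension_\<phi>[OF assms] differential_\<phi>[OF assms]
    using nonzero(1)[OF assms]
    by (simp add: vec_eq_iff forall_2 coord_field_def axis_def field_simps power2_eq_square)
qed

text \<open>
  The left-hand side is the field whose vanishing on \<open>M\<close> defines \<open>f\<close>-biharmonicity; the components on
  the right are those of the partial differential system, the second one multiplied by two.
\<close>

lemma f_bitension_\<phi>:
  assumes "open M" "M \<subseteq> {q. q $ 1 \<in> I}" "smooth_on M f" "p \<in> M"
    and F: "\<And>q. q \<in> M \<Longrightarrow> F q = tau (q $ 1) * f q"
  shows "f p *\<^sub>R bitension g h \<phi> p + laplacian g f p *\<^sub>R tension g h \<phi> p
      + 2 *\<^sub>R pullback_cov h \<phi> (gradient g f) (tension g h \<phi>) p =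
    vector [laplacian g F p
        - k\<^sup>2 * deriv (\<lambda>s. lam s * deriv lam s) (\<rho> (p $ 1)) / (\<sigma> (p $ 1))\<^sup>2 * (tau (p $ 1) * f p),
      2 * (k * partial_deriv 2 f p * deriv lam (\<rho> (p $ 1)) * tau (p $ 1)
        / ((\<sigma> (p $ 1))\<^sup>2 * lam (\<rho> (p $ 1))))]"
proof -
  have p: "p $ 1 \<in> I" using assms by auto
  have L: "laplacian g F p = tau (p $ 1) * laplacian g f p + 2 * deriv tau (p $ 1) * partial_deriv 1 f p
    + (deriv (deriv tau) (p $ 1) + deriv \<sigma> (p $ 1) / \<sigma> (p $ 1) * deriv tau (p $ 1)) * f p"
    by (rule laplacian_radial_mult[OF I twice_diff(1) nonzero(1) twice_diff_on_tau assms(1,3,4,2) F])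
  show ?thesis
    unfolding bitension_\<phi>[OF p] tension_\<phi>[OF p] pullback_cov_tension_\<phi>[OF p] L
      gradient_rot_metric[of \<sigma> p, OF nonzero(1)[OF p]]
    using nonzero(1)[OF p] nonzero(2)[OF \<rho>_in[OF p]]
    by (simp add: vec_eq_iff forall_2) (simp add: algebra_simps)
qed

text \<open>
  By this identity the third equation of the system determines \<open>x\<close> on \<open>M\<close>, as the component \<open>tau\<close> of
  the tension field, so that the existential quantifier over \<open>x\<close> leaves no choice.
\<close>

lemma laplacian_\<rho>:
  assumes "p $ 1 \<in> I"
  shows "laplacian g (\<lambda>q. \<rho> (q $ 1)) p
      - k\<^sup>2 * lam (\<rho> (p $ 1)) * deriv lam (\<rho> (p $ 1)) / (\<sigma> (p $ 1))\<^sup>2 = tau (p $ 1)"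
  using laplacian_radial[OF I twice_diff(1) nonzero(1) twice_diff(5) assms] by (simp add: tau_def)

end

section \<open>The two characterizations\<close>

theorem corollary2p5:
  fixes k :: real
    and I J K :: "real set"
    and \<sigma> lam \<rho> :: "real \<Rightarrow> real"
    and f :: "real ^ 2 \<Rightarrow> real"
    and M :: "(real ^ 2) set"
  assumes I: "open I" "is_interval I" "I \<noteq> {}"
    and J: "open J" "is_interval J" "J \<noteq> {}"
    and K: "open K" "is_interval K"
    and M: "M = {p. p $ 1 \<in> I \<and> p $ 2 \<in> J}"
    and \<sigma>: "smooth_on I \<sigma>" "\<forall>r\<in>I. \<sigma> r > 0"
    and lam: "smooth_on K lam" "\<forall>s\<in>K. lam s > 0"
    and \<rho>: "smooth_on I \<rho>" "\<rho> ` I \<subseteq> K"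
    and f: "smooth_on M f" "\<forall>p\<in>M. f p > 0"
  shows "(f_biharmonic_on M (rot_metric \<sigma>) (rot_metric lam) f (rot_map \<rho> k) \<longleftrightarrow>
           (\<exists>x :: real ^ 2 \<Rightarrow> real. \<forall>p\<in>M.
              laplacian (rot_metric \<sigma>) (\<lambda>q. x q * f q) p
                = k\<^sup>2 * deriv (\<lambda>s. lam s * deriv lam s) (\<rho> (p $ 1)) / (\<sigma> (p $ 1))\<^sup>2 * (x p * f p) \<and>
              k * partial_deriv 2 f p * deriv lam (\<rho> (p $ 1)) * x p
                / ((\<sigma> (p $ 1))\<^sup>2 * lam (\<rho> (p $ 1))) = 0 \<and>
              x p = laplacian (rot_metric \<sigma>) (\<lambda>q. \<rho> (q $ 1)) p
                - k\<^sup>2 * lam (\<rho> (p $ 1)) * deriv lam (\<rho> (p $ 1)) / (\<sigma> (p $ 1))\<^sup>2))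
       \<and> (\<forall>F :: real \<Rightarrow> real. (\<forall>p\<in>M. f p = F (p $ 1)) \<longrightarrow>
           (f_biharmonic_on M (rot_metric \<sigma>) (rot_metric lam) f (rot_map \<rho> k) \<longleftrightarrow>
             (\<exists>x y :: real \<Rightarrow> real. \<forall>r\<in>I.
                deriv (deriv y) r + deriv \<sigma> r / \<sigma> r * deriv y r
                  - k\<^sup>2 * deriv (\<lambda>s. lam s * deriv lam s) (\<rho> r) / (\<sigma> r)\<^sup>2 * y r = 0 \<and>
                y r = F r * x r \<and>
                x r = deriv (deriv \<rho>) r + deriv \<sigma> r / \<sigma> r * deriv \<rho> r
                  - k\<^sup>2 * lam (\<rho> r) * deriv lam (\<rho> r) / (\<sigma> r)\<^sup>2)))"
proof -
  interpret rotational_map I K \<sigma> lam \<rho> k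
    using I K \<sigma> lam \<rho> by unfold_locales auto
  have openM: "open M" and MI: "M \<subseteq> {q. q $ 1 \<in> I}"
    using open_Int[OF open_vimage_vec_nth[OF I(1), of 1] open_vimage_vec_nth[OF J(1), of 2]]
    by (auto simp: M vimage_def Int_def)
  define \<mu> where "\<mu> r = k\<^sup>2 * deriv (\<lambda>s. lam s * deriv lam s) (\<rho> r) / (\<sigma> r)\<^sup>2" for r
  \<comment> \<open>\<open>F\<close> stands for \<open>x f\<close> and is prescribed on \<open>M\<close> only, since \<open>x\<close> is arbitrary outside \<open>M\<close>.\<close>
  have biharm: "f_biharmonic_on M g h f \<phi> \<longleftrightarrow> (\<forall>p\<in>M. laplacian g F p = \<mu> (p $ 1) * (tau (p $ 1) * f p) \<and>
      k * partial_deriv 2 f p * deriv lam (\<rho> (p $ 1)) * tau (p $ 1)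
        / ((\<sigma> (p $ 1))\<^sup>2 * lam (\<rho> (p $ 1))) = 0)"
    if "\<And>q. q \<in> M \<Longrightarrow> F q = tau (q $ 1) * f q" for F
    unfolding f_biharmonic_on_def \<mu>_def using f_bitension_\<phi>[OF openM MI f(1) _ that]
    by (intro ball_cong) (simp_all add: vec_eq_iff forall_2)
  show ?thesis
  proof (intro conjI allI impI, goal_cases)
    case 1
    show ?case (is "_ \<longleftrightarrow> (\<exists>x. \<forall>p\<in>M. ?E1 x p \<and> ?E2 x p \<and> ?E3 x p)")
    proof
      assume "f_biharmonic_on M g h f \<phi>"
      then have "\<forall>p\<in>M. ?E1 (\<lambda>q. tau (q $ 1)) p \<and> ?E2 (\<lambda>q. tau (q $ 1)) p"
        using biharm[of "\<lambda>q. tau (q $ 1) * f q"] by (simp add: \<mu>_def)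
      moreover have "\<forall>p\<in>M. ?E3 (\<lambda>q. tau (q $ 1)) p"
        using laplacian_\<rho> MI by auto
      ultimately show "\<exists>x. \<forall>p\<in>M. ?E1 x p \<and> ?E2 x p \<and> ?E3 x p"
        by (intro exI[of _ "\<lambda>q. tau (q $ 1)"]) blast
    next
      assume "\<exists>x. \<forall>p\<in>M. ?E1 x p \<and> ?E2 x p \<and> ?E3 x p"
      then obtain x where x: "\<forall>p\<in>M. ?E1 x p \<and> ?E2 x p \<and> ?E3 x p" ..
      then have "x p = tau (p $ 1)" if "p \<in> M" for p
        using laplacian_\<rho> MI that by auto
      then show "f_biharmonic_on M g h f \<phi>"
        using x by (subst biharm[of "\<lambda>q. x q * f q"]) (auto simp: \<mu>_def)
    qed
  next
    case (2 F)
    \<comment> \<open>Regularity of \<open>F\<close> on \<open>I\<close> is inherited from \<open>f\<close> along a slice of constant angle.\<close>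
    obtain \<theta> where \<theta>: "\<theta> \<in> J" using J(3) by blast
    have inM: "(vector [r, \<theta>] :: real ^ 2) \<in> M" if "r \<in> I" for r
      using that \<theta> by (simp add: M)
    have img: "I = (\<lambda>p. p $ 1) ` M"
    proof
      show "I \<subseteq> (\<lambda>p. p $ 1) ` M"
      proof
        fix r assume "r \<in> I"
        then show "r \<in> (\<lambda>p. p $ 1) ` M"
          using imageI[OF inM, of r "\<lambda>p. p $ 1"] by simp
      qed
      show "(\<lambda>p. p $ 1) ` M \<subseteq> I"
        using MI by auto
    qed
    define Y where "Y r = F r * tau r" for r
    have F: "twice_diff_on I F"
    proof (rule twice_diff_onI)
      fix r assume r: "r \<in> I"
      have diff: "f differentiable (at (vector [r, \<theta>]))"
          "partial_deriv 1 f differentiable (at (vector [r, \<theta>]))"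
        using f(1) inM[OF r] by (auto intro: smooth_on_differentiable smooth_on_partial_deriv)
      show "(F has_real_derivative partial_deriv 1 f (vector [r, \<theta>])) (at r)"
        by (rule has_field_derivative_transform_within_open[OF has_real_derivative_slice[OF diff(1)] I(1) r])
          (use 2 inM in simp)
      show "(\<lambda>r. partial_deriv 1 f (vector [r, \<theta>])) field_differentiable (at r)"
        using has_real_derivative_slice[OF diff(2)] by (auto simp: field_differentiable_def)
    qed
    have Y: "twice_diff_on I Y"
      unfolding Y_def by (intro twice_diff_on_mult F twice_diff_on_tau)
    have Yf: "Y (p $ 1) = tau (p $ 1) * f p" if "p \<in> M" for p
      using 2 that by (simp add: Y_def)
    have f2: "partial_deriv 2 f p = 0" if "p \<in> M" for p
    proof -
      have "partial_deriv 2 f p = partial_deriv 2 (\<lambda>q. F (q $ 1)) p"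
        using 2 that by (intro differential_cong_open[OF openM]) auto
      also have "\<dots> = deriv F (p $ 1) * coord_field (2 :: 2) p $ 1"
        using MI that by (intro differential_radial twice_diff_on_deriv(1)[OF I(1) F]) auto
      finally show ?thesis
        by (simp add: coord_field_def axis_def)
    qed
    have L: "laplacian g (\<lambda>q. Y (q $ 1)) p = deriv (deriv Y) (p $ 1)
        + deriv \<sigma> (p $ 1) / \<sigma> (p $ 1) * deriv Y (p $ 1)" if "p \<in> M" for p
      using laplacian_radial[OF I(1) twice_diff(1) nonzero(1) Y] MI that by blast
    let ?ode = "\<lambda>y r. deriv (deriv y) r + deriv \<sigma> r / \<sigma> r * deriv y r - \<mu> r * y r = 0"
    have "f_biharmonic_on M g h f \<phi> \<longleftrightarrow> (\<forall>p\<in>M. ?ode Y (p $ 1))"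
      by (subst biharm[of "\<lambda>q. Y (q $ 1)", OF Yf]) (auto simp: L f2 simp flip: Yf)
    also have "\<dots> \<longleftrightarrow> (\<forall>r\<in>I. ?ode Y r)"
      by (subst img) simp
    also have "\<dots> \<longleftrightarrow> (\<exists>x y. \<forall>r\<in>I. ?ode y r \<and> y r = F r * x r \<and> x r = tau r)"
    proof
      assume "\<forall>r\<in>I. ?ode Y r"
      then show "\<exists>x y. \<forall>r\<in>I. ?ode y r \<and> y r = F r * x r \<and> x r = tau r"
        by (intro exI[of _ tau] exI[of _ Y]) (simp add: Y_def)
    next
      assume "\<exists>x y. \<forall>r\<in>I. ?ode y r \<and> y r = F r * x r \<and> x r = tau r"
      then obtain x y where "\<forall>r\<in>I. ?ode y r \<and> y r = F r * x r \<and> x r = tau r"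
        by blast
      then have y: "\<forall>r\<in>I. ?ode y r \<and> y r = Y r"
        by (simp add: Y_def)
      have d: "deriv y r = deriv Y r" if "r \<in> I" for r
        by (rule deriv_cong_open[OF I(1) that]) (use y in simp)
      have "deriv (deriv y) r = deriv (deriv Y) r" if "r \<in> I" for r
        by (rule deriv_cong_open[OF I(1) that d])
      then show "\<forall>r\<in>I. ?ode Y r"
        using y d by simp
    qed
    finally show ?case
      by (simp add: \<mu>_def tau_def)
  qed
qed

end
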